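(* Let $i,m$ be integers with $2\le i\le m$, suppose $\mathbb{E}|X_{i:m+1}|<\infty$, and let $h$ be a differentiable function on $(a,b)$. If $$\mathbb{E}(X_{i:m+1}\mid X_{i:m})=X_{i:m}-h(X_{i:m})\quad\text{almost surely},$$ then $$F(x)=\frac{h^{-\frac{1}{i-1}}(x)}{h^{-\frac{1}{i-1}}(b^-)+\frac{1}{i-1}\int_x^b h^{-\frac{i}{i-1}}(t)\,dt},\qquad x\in(a,b).$$
   Context: $X_1,X_2,\ldots$ are independent identically distributed real random variables with cumulative distribution function $F$, absolutely continuous with respect to Lebesgue measure, and the density $f=F'$ is strictly positive on $(a,b):=\{x\in\mathbb{R}:0<F(x)<1\}$, where $-\infty\le a<b\le\infty$. $X_{i:m}$ denotes the $i$-th smallest among $X_1,\ldots,X_m$. Here $h(b^-)=\lim_{x\to b^-}h(x)$ and $h^{-c}(x)$ means $(h(x))^{-c}$; if $h(b^-)=\infty$, then $h^{-\frac{1}{i-1}}(b^-)$ is taken to be $0$. *)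

theory Defs
  imports "HOL-Probability.Probability"
begin

(* The sample is indexed from 1: X_{i:m} is the i-th smallest (1 <= i <= m) of X_1, ..., X_m. *)
definition order_stat :: "(nat \<Rightarrow> 'a \<Rightarrow> real) \<Rightarrow> nat \<Rightarrow> nat \<Rightarrow> 'a \<Rightarrow> real" where
  "order_stat X i m \<omega> = sort (map (\<lambda>k. X k \<omega>) [1..<Suc m]) ! (i - 1)"

(* L^(-c) for a limit value L in (0, \<infinity>] and c > 0, with the convention \<infinity>^(-c) = 0. *)
definition neg_powr :: "ereal \<Rightarrow> real \<Rightarrow> real" where
  "neg_powr L c = (if L = \<infinity> then 0 else real_of_ereal L powr (- c))"

end

theory Submission imports Defs begin

text \<open>
  Write Z and W for the i-th order statistics of m and of m+1 observations, so W \<le> Z, and put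
  G(x) for the integral of F^i over (-\<infinity>, x]. For t < Z \<le> y the event W \<le> t < Z says that exactly i-1 of
  the first m observations and also the last one are \<le> t, so Fubini bounds the mean of Z - W on
  x < Z \<le> y between K G(x) and K G(y), where
  K = binom(m, i-1) ((1-F(x))^(m-i+1) - (1-F(y))^(m-i+1)). By the regression hypothesis that mean is
  also the mean of h(Z) on the same event. Dividing by F(y) - F(x) and letting y decrease to x gives
  h F^(i-1) = G on (a,b); no density of an order statistic is needed. Since G' = F^i, this says
  (G^(-1/(i-1)))' = - h^(-i/(i-1)) / (i-1), which is integrated from x to b.
\<close>

section \<open>Order statistics and counting variables\<close>

text \<open>Quotients are taken in F(y) - F(x) and not in y - x: a density makes F differentiable
  only almost everywhere, while the identity is wanted at every x of (a,b). Strict monotonicity of F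
  there keeps the denominators nonzero. In the limit K contributes binom(m, i-1) (m-i+1)
  (1-F(x))^(m-i), and the probability of x < Z \<le> y contributes the same number times F(x)^(i-1),
  as the derivative of a binomial tail in the variable u = F. Continuity of h replaces h(Z) by h(x)
  up to a smaller-order error. The common factor is nonzero because F(x) < 1; cancelling it removes
  all trace of m. Finiteness of G is itself a consequence: Z is bounded on x < Z \<le> y and W is
  integrable, so the mean gap is finite there, and the lower bound K G(x) with K > 0 passes this on
  to G. The limit of h at b comes from h = G / F^(i-1), with G monotone and F tending to 1; it may
  be infinite.\<close>

text \<open>In a sorted list the entries \<le> t form an initial segment, so position i - 1, counted
  from 0, belongs to it exactly when the segment has at least i entries.\<close>

lemma sort_nth_le_iff:
  fixes xs :: "real list"
  assumes "1 \<le> i" "i \<le> length xs"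
  shows "sort xs ! (i - 1) \<le> t \<longleftrightarrow> i \<le> length (filter (\<lambda>x. x \<le> t) xs)"
proof -
  define ys where "ys = sort xs"
  have ys: "sorted ys" "length ys = length xs" unfolding ys_def by auto
  have "length (filter (\<lambda>x. x \<le> t) xs) = length (filter (\<lambda>x. x \<le> t) ys)"
    by (rule mset_eq_length) (simp add: ys_def)
  also have "\<dots> = card {k. k < length ys \<and> ys ! k \<le> t}"
    by (simp add: length_filter_conv_card)
  finally have len: "length (filter (\<lambda>x. x \<le> t) xs) = card {k. k < length ys \<and> ys ! k \<le> t}" .
  show ?thesis unfolding len ys_def[symmetric]
  proof
    assume le: "ys ! (i - 1) \<le> t"
    have "{..<i} \<subseteq> {k. k < length ys \<and> ys ! k \<le> t}"
    proof
      fix k assume "k \<in> {..<i}"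
      then have "k \<le> i - 1" "i - 1 < length ys" using assms ys by auto
      then show "k \<in> {k. k < length ys \<and> ys ! k \<le> t}"
        using sorted_nth_mono[OF ys(1), of k "i - 1"] le by auto
    qed
    then show "i \<le> card {k. k < length ys \<and> ys ! k \<le> t}"
      using card_mono[of "{k. k < length ys \<and> ys ! k \<le> t}" "{..<i}"] by simp
  next
    assume i: "i \<le> card {k. k < length ys \<and> ys ! k \<le> t}"
    show "ys ! (i - 1) \<le> t"
    proof (rule ccontr)
      assume gt: "\<not> ys ! (i - 1) \<le> t"
      have "{k. k < length ys \<and> ys ! k \<le> t} \<subseteq> {..<i - 1}"
      proof
        fix k assume k: "k \<in> {k. k < length ys \<and> ys ! k \<le> t}"
        show "k \<in> {..<i - 1}"
        proof (rule ccontr)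
          assume "k \<notin> {..<i - 1}"
          then have "ys ! (i - 1) \<le> ys ! k"
            using k by (intro sorted_nth_mono[OF ys(1)]) auto
          then show False using k gt by simp
        qed
      qed
      then have "card {k. k < length ys \<and> ys ! k \<le> t} \<le> i - 1"
        by (rule order_trans[OF card_mono[OF finite_lessThan]]) simp
      then show False using i assms by linarith
    qed
  qed
qed

text \<open>This is n times the empirical distribution function at t. Events about order statistics
  become events about this integer, whose probabilities are binomial.\<close>

definition count_le :: "(nat \<Rightarrow> 'a \<Rightarrow> real) \<Rightarrow> nat \<Rightarrow> real \<Rightarrow> 'a \<Rightarrow> nat" where
  "count_le X n t \<omega> = card {j \<in> {1..n}. X j \<omega> \<le> t}"

lemma order_stat_le_iff:
  assumes "1 \<le> i" "i \<le> n"
  shows "order_stat X i n \<omega> \<le> t \<longleftrightarrow> i \<le> count_le X n t \<omega>"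
proof -
  let ?js = "filter (\<lambda>j. X j \<omega> \<le> t) [1..<Suc n]"
  have "length (filter (\<lambda>x. x \<le> t) (map (\<lambda>k. X k \<omega>) [1..<Suc n])) = length ?js"
    by (simp only: filter_map length_map comp_def)
  also have "\<dots> = card (set ?js)"
    by (rule distinct_card[symmetric]) simp
  also have "set ?js = {j \<in> {1..n}. X j \<omega> \<le> t}" by auto
  finally have len: "length (filter (\<lambda>x. x \<le> t) (map (\<lambda>k. X k \<omega>) [1..<Suc n])) = count_le X n t \<omega>"
    unfolding count_le_def .
  have "i \<le> length (map (\<lambda>k. X k \<omega>) [1..<Suc n])"
    using assms by simp
  from sort_nth_le_iff[OF assms(1) this, of t] show ?thesis
    unfolding order_stat_def len .
qed

lemma count_le_Suc: "count_le X (Suc n) t \<omega> = count_le X n t \<omega> + (if X (Suc n) \<omega> \<le> t then 1 else 0)"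
proof -
  have "{j \<in> {1..Suc n}. X j \<omega> \<le> t} = {j \<in> {1..n}. X j \<omega> \<le> t} \<union> (if X (Suc n) \<omega> \<le> t then {Suc n} else {})"
    by (auto simp: le_Suc_eq)
  then show ?thesis unfolding count_le_def by simp
qed

lemma count_le_mono: "s \<le> t \<Longrightarrow> count_le X n s \<omega> \<le> count_le X n t \<omega>"
  unfolding count_le_def by (intro card_mono) auto

lemma measurable_count_le:
  assumes "\<And>j. 1 \<le> j \<Longrightarrow> X j \<in> borel_measurable M"
  shows "count_le X n t \<in> measurable M (count_space UNIV)"
proof (induction n)
  case 0
  then show ?case by (simp add: count_le_def)
next
  case (Suc n)
  have [measurable]: "X (Suc n) \<in> borel_measurable M" using assms by simp
  note Suc [measurable]
  show ?case unfolding count_le_Suc by measurable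
qed

lemma borel_measurable_order_stat:
  assumes "\<And>j. 1 \<le> j \<Longrightarrow> X j \<in> borel_measurable M" "1 \<le> i" "i \<le> n"
  shows "order_stat X i n \<in> borel_measurable M"
  unfolding borel_measurable_iff_le
proof
  fix t
  have [measurable]: "count_le X n t \<in> measurable M (count_space UNIV)"
    by (intro measurable_count_le assms)
  show "{w \<in> space M. order_stat X i n w \<le> t} \<in> sets M"
    unfolding order_stat_le_iff[OF assms(2,3)] by measurable
qed

text \<open>A further observation can only raise the counts, hence can only lower the i-th smallest
  value.\<close>

lemma order_stat_Suc_le:
  assumes "1 \<le> i" "i \<le> n"
  shows "order_stat X i (Suc n) \<omega> \<le> order_stat X i n \<omega>"
proof -
  have "i \<le> count_le X n (order_stat X i n \<omega>) \<omega>"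
    by (rule iffD1[OF order_stat_le_iff[OF assms] order_refl])
  then have "i \<le> count_le X (Suc n) (order_stat X i n \<omega>) \<omega>"
    unfolding count_le_Suc by simp
  then show ?thesis
    by (rule iffD2[OF order_stat_le_iff[OF assms(1) le_SucI[OF assms(2)]]])
qed

section \<open>Binomial and multinomial probabilities\<close>

text \<open>The event is split according to the set \<open>S\<close> of the r indices whose
  observations fall into A. The pieces are disjoint because A and B are, and independence turns each
  into the same product. The observation with index \<open>Suc n\<close> is carried along because
  the gap between the two order statistics depends on it.\<close>

lemma (in prob_space) prob_split:
  fixes X :: "nat \<Rightarrow> 'a \<Rightarrow> real"
  assumes ind: "indep_vars (\<lambda>_. borel) X {1..}"
    and D: "\<And>j. 1 \<le> j \<Longrightarrow> distr M borel (X j) = D"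
    and [measurable]: "A \<in> sets borel" "B \<in> sets borel" "C \<in> sets borel" and AB: "A \<inter> B = {}"
  shows "prob {\<omega> \<in> space M. X (Suc n) \<omega> \<in> C \<and> (\<forall>j\<in>{1..n}. X j \<omega> \<in> A \<union> B) \<and> card {j \<in> {1..n}. X j \<omega> \<in> A} = r}
    = measure D C * real (n choose r) * measure D A ^ r * measure D B ^ (n - r)"
proof -
  have X: "random_variable borel (X j)" if "1 \<le> j" for j
    using ind that unfolding indep_vars_def by auto
  define \<S> where "\<S> = {S. S \<subseteq> {1..n} \<and> card S = r}"
  define E where "E S j = (if j = Suc n then C else if j \<in> S then A else B)" for S j
  define V where "V S = (\<Inter>j\<in>{1..Suc n}. X j -` E S j \<inter> space M)" for S
  have E[measurable]: "E S j \<in> sets borel" for S j unfolding E_def by auto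
  have [simp]: "finite \<S>" unfolding \<S>_def by simp
  have eq: "{\<omega> \<in> space M. X (Suc n) \<omega> \<in> C \<and> (\<forall>j\<in>{1..n}. X j \<omega> \<in> A \<union> B) \<and> card {j \<in> {1..n}. X j \<omega> \<in> A} = r} = (\<Union>S\<in>\<S>. V S)"
    (is "?L = ?R")
  proof
    show "?L \<subseteq> ?R"
    proof
      fix \<omega> assume w: "\<omega> \<in> ?L"
      let ?S = "{j \<in> {1..n}. X j \<omega> \<in> A}"
      have "?S \<in> \<S>" using w unfolding \<S>_def by auto
      moreover have "\<omega> \<in> V ?S"
        using w unfolding V_def E_def by (auto simp: le_Suc_eq)
      ultimately show "\<omega> \<in> ?R" by blast
    qed
    show "?R \<subseteq> ?L"
    proof
      fix \<omega> assume "\<omega> \<in> ?R"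
      then obtain S where S: "S \<subseteq> {1..n}" "card S = r" and w: "\<omega> \<in> V S" unfolding \<S>_def by auto
      have sp: "\<omega> \<in> space M" using w unfolding V_def by auto
      have "X (Suc n) \<omega> \<in> E S (Suc n)" using w unfolding V_def by auto
      then have c: "X (Suc n) \<omega> \<in> C" unfolding E_def by simp
      have j: "X j \<omega> \<in> (if j \<in> S then A else B)" if "j \<in> {1..n}" for j
      proof -
        have "X j \<omega> \<in> E S j" using w that unfolding V_def by auto
        then show ?thesis using that unfolding E_def by simp
      qed
      have "X j \<omega> \<in> A \<longleftrightarrow> j \<in> S" if "j \<in> {1..n}" for j
        using j[OF that] AB by (auto split: if_splits)
      then have "{j \<in> {1..n}. X j \<omega> \<in> A} = S"
        using S(1) by blast
      moreover have "\<forall>j\<in>{1..n}. X j \<omega> \<in> A \<union> B"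
        using j by (metis UnCI)
      ultimately show "\<omega> \<in> ?L" using sp c S(2) by simp
    qed
  qed
  have disj: "disjoint_family_on V \<S>"
  proof (unfold disjoint_family_on_def, intro ballI impI, rule ccontr)
    fix S T assume S: "S \<in> \<S>" and T: "T \<in> \<S>" and ne: "S \<noteq> T" "V S \<inter> V T \<noteq> {}"
    then obtain \<omega> where w: "\<omega> \<in> V S" "\<omega> \<in> V T" by auto
    have "j \<in> S \<longleftrightarrow> j \<in> T" if "j \<in> {1..n}" for j
    proof -
      have "X j \<omega> \<in> E S j \<inter> E T j" using w that unfolding V_def by auto
      then show ?thesis using that AB unfolding E_def by (auto split: if_splits)
    qed
    then show False using S T ne unfolding \<S>_def by blast
  qed
  have meas: "V S \<in> events" for S
    unfolding V_def using X E by (intro sets.finite_INT measurable_sets) auto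
  have pV: "prob (V S) = measure D C * measure D A ^ r * measure D B ^ (n - r)" if "S \<in> \<S>" for S
  proof -
    have S: "S \<subseteq> {1..n}" "card S = r" using that unfolding \<S>_def by auto
    have "prob (V S) = (\<Prod>j\<in>{1..Suc n}. prob (X j -` E S j \<inter> space M))"
      unfolding V_def by (intro indep_varsD[OF ind]) auto
    also have "\<dots> = (\<Prod>j\<in>{1..Suc n}. measure D (E S j))"
    proof (intro prod.cong refl)
      fix j assume "j \<in> {1..Suc n}"
      then show "prob (X j -` E S j \<inter> space M) = measure D (E S j)"
        using D[of j] measure_distr[OF X E, of j S j] by auto
    qed
    also have "\<dots> = (\<Prod>j\<in>{1..n}. measure D (E S j)) * measure D C"
      by (simp add: E_def)
    also have "(\<Prod>j\<in>{1..n}. measure D (E S j)) = (\<Prod>j\<in>{1..n}. if j \<in> S then measure D A else measure D B)"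
      by (intro prod.cong refl) (auto simp: E_def)
    also have "\<dots> = measure D A ^ card ({1..n} \<inter> S) * measure D B ^ card ({1..n} \<inter> - S)"
      by (subst prod.If_cases) auto
    also have "{1..n} \<inter> S = S" using S by auto
    also have "card ({1..n} \<inter> - S) = n - r"
      using S card_Diff_subset[of S "{1..n}"] by (simp add: Diff_eq finite_subset)
    finally show ?thesis using S by simp
  qed
  have "prob ?L = (\<Sum>S\<in>\<S>. prob (V S))"
    unfolding eq using meas disj by (intro finite_measure_finite_Union) auto
  also have "\<dots> = real (card \<S>) * (measure D C * measure D A ^ r * measure D B ^ (n - r))"
    using pV by simp
  also have "card \<S> = n choose r"
    unfolding \<S>_def using n_subsets[of "{1..n}" r] by simp
  finally show ?thesis by simp
qed

text \<open>Equal counts at t \<le> s mean that none of the n observations lies in (t, s], so all of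
  them lie in \<open>{..t} \<union> {s<..}\<close>. The case t = s is the ordinary binomial
  law.\<close>

lemma (in prob_space) prob_count_le:
  fixes X :: "nat \<Rightarrow> 'a \<Rightarrow> real"
  assumes ind: "indep_vars (\<lambda>_. borel) X {1..}"
    and D: "\<And>j. 1 \<le> j \<Longrightarrow> distr M borel (X j) = D"
    and C: "C \<in> sets borel" and ts: "t \<le> s"
  shows "prob {\<omega> \<in> space M. X (Suc n) \<omega> \<in> C \<and> count_le X n t \<omega> = r \<and> count_le X n s \<omega> = r}
    = measure D C * real (n choose r) * cdf D t ^ r * (1 - cdf D s) ^ (n - r)"
proof -
  have X1: "random_variable borel (X 1)"
    using ind unfolding indep_vars_def by auto
  then interpret D: prob_space D
    using D[of 1] prob_space_distr[of "X 1" borel] by simp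
  have sD: "sets D = sets borel" "space D = UNIV" using D[of 1] by auto
  have "measure D {s<..} = measure D (space D - {..s})"
    by (rule arg_cong[where f="measure D"]) (auto simp: sD)
  also have "\<dots> = 1 - cdf D s"
    unfolding cdf_def by (rule D.prob_compl) (simp add: sD)
  finally have s: "measure D {s<..} = 1 - cdf D s" .
  have split: "(count_le X n t \<omega> = r \<and> count_le X n s \<omega> = r) \<longleftrightarrow>
      (\<forall>j\<in>{1..n}. X j \<omega> \<in> {..t} \<union> {s<..}) \<and> card {j \<in> {1..n}. X j \<omega> \<in> {..t}} = r" for \<omega>
  proof -
    let ?T = "{j \<in> {1..n}. X j \<omega> \<le> t}" and ?S = "{j \<in> {1..n}. X j \<omega> \<le> s}"
    have sub: "?T \<subseteq> ?S" using ts by auto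
    have "count_le X n t \<omega> = r \<and> count_le X n s \<omega> = r \<longleftrightarrow> card ?T = card ?S \<and> card ?T = r"
      unfolding count_le_def by auto
    also have "\<dots> \<longleftrightarrow> ?T = ?S \<and> card ?T = r"
      using card_subset_eq[OF _ sub] by auto
    also have "?T = ?S \<longleftrightarrow> (\<forall>j\<in>{1..n}. X j \<omega> \<in> {..t} \<union> {s<..})"
      using ts by force
    finally show ?thesis by simp
  qed
  have "{..t} \<inter> {s<..} = {}" using ts by auto
  then have "prob {\<omega> \<in> space M. X (Suc n) \<omega> \<in> C \<and> (\<forall>j\<in>{1..n}. X j \<omega> \<in> {..t} \<union> {s<..}) \<and>
      card {j \<in> {1..n}. X j \<omega> \<in> {..t}} = r}
    = measure D C * real (n choose r) * measure D {..t} ^ r * measure D {s<..} ^ (n - r)"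
    using C by (intro prob_split[OF ind D]) auto
  moreover have "measure D {..t} = cdf D t" by (simp add: cdf_def)
  ultimately show ?thesis unfolding split s by simp
qed

text \<open>The condition on the upper end y removes a smaller event of the same shape, so the
  probability is a difference of two values of \<open>prob_count_le\<close>. The exponent i collects
  the i - 1 small observations among the first m and the new one.\<close>

lemma (in prob_space) prob_order_stat_between:
  fixes X :: "nat \<Rightarrow> 'a \<Rightarrow> real"
  assumes ind: "indep_vars (\<lambda>_. borel) X {1..}"
    and D: "\<And>j. 1 \<le> j \<Longrightarrow> distr M borel (X j) = D"
    and i: "1 \<le> i" "i \<le> m" and t: "t < y" and x: "x < y"
  shows "prob {\<omega> \<in> space M. order_stat X i (Suc m) \<omega> \<le> t \<and> t < order_stat X i m \<omega> \<and>
      x < order_stat X i m \<omega> \<and> order_stat X i m \<omega> \<le> y}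
    = real (m choose (i - 1)) * cdf D t ^ i *
      ((1 - cdf D (max t x)) ^ (m - (i - 1)) - (1 - cdf D y) ^ (m - (i - 1)))"
proof -
  have X: "random_variable borel (X j)" if "1 \<le> j" for j
    using ind that unfolding indep_vars_def by auto
  note [measurable] = X[of "Suc m", simplified]
  have [measurable]: "count_le X m u \<in> measurable M (count_space UNIV)" for u
    by (intro measurable_count_le X)
  define E where "E s = {\<omega> \<in> space M. X (Suc m) \<omega> \<in> {..t} \<and> count_le X m t \<omega> = i - 1 \<and> count_le X m s \<omega> = i - 1}" for s
  have E[measurable]: "E s \<in> events" for s unfolding E_def by measurable
  \<comment> \<open>Being above both t and x means being above s. The count at s is then below i and
    at least the count at t, which is i - 1, so it equals i - 1 as well.\<close>
  define s where "s = max t x"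
  have s: "t \<le> s" "x \<le> s" "s \<le> y" using t x by (auto simp: s_def)
  have eq: "{\<omega> \<in> space M. order_stat X i (Suc m) \<omega> \<le> t \<and> t < order_stat X i m \<omega> \<and>
      x < order_stat X i m \<omega> \<and> order_stat X i m \<omega> \<le> y} = E s - E y"
  proof (intro set_eqI)
    fix \<omega>
    have mono: "count_le X m t \<omega> \<le> count_le X m s \<omega>" "count_le X m x \<omega> \<le> count_le X m s \<omega>"
      "count_le X m s \<omega> \<le> count_le X m y \<omega>"
      using s by (auto intro: count_le_mono)
    have cs: "count_le X m s \<omega> = count_le X m t \<omega> \<or> count_le X m s \<omega> = count_le X m x \<omega>"
      unfolding s_def by (auto simp: max_def)
    have W: "order_stat X i (Suc m) \<omega> \<le> t \<longleftrightarrow> i \<le> count_le X m t \<omega> + (if X (Suc m) \<omega> \<le> t then 1 else 0)"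
      by (subst order_stat_le_iff) (use i in \<open>auto simp only: count_le_Suc\<close>)
    have Z: "order_stat X i m \<omega> \<le> u \<longleftrightarrow> i \<le> count_le X m u \<omega>" for u
      by (rule order_stat_le_iff[OF i])
    show "\<omega> \<in> {\<omega> \<in> space M. order_stat X i (Suc m) \<omega> \<le> t \<and> t < order_stat X i m \<omega> \<and>
      x < order_stat X i m \<omega> \<and> order_stat X i m \<omega> \<le> y} \<longleftrightarrow> \<omega> \<in> E s - E y"
      unfolding E_def mem_Collect_eq Diff_iff W not_le[symmetric] Z
      using mono cs i by (auto split: if_splits)
  qed
  have "prob (E s - E y) = prob (E s) - prob (E y)"
  proof (rule finite_measure_Diff[OF E E])
    show "E y \<subseteq> E s"
    proof
      fix \<omega> assume "\<omega> \<in> E y"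
      moreover have "count_le X m t \<omega> \<le> count_le X m s \<omega>" "count_le X m s \<omega> \<le> count_le X m y \<omega>"
        using s by (auto intro: count_le_mono)
      ultimately show "\<omega> \<in> E s" unfolding E_def by auto
    qed
  qed
  also have "prob (E s) = cdf D t * real (m choose (i - 1)) * cdf D t ^ (i - 1) * (1 - cdf D s) ^ (m - (i - 1))"
    unfolding E_def using prob_count_le[OF ind D, of "{..t}" t s m "i - 1"] s by (simp add: cdf_def)
  also have "prob (E y) = cdf D t * real (m choose (i - 1)) * cdf D t ^ (i - 1) * (1 - cdf D y) ^ (m - (i - 1))"
    unfolding E_def using prob_count_le[OF ind D, of "{..t}" t y m "i - 1"] t by (simp add: cdf_def)
  finally have "prob (E s - E y) = real (m choose (i - 1)) * (cdf D t * cdf D t ^ (i - 1)) *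
      ((1 - cdf D s) ^ (m - (i - 1)) - (1 - cdf D y) ^ (m - (i - 1)))"
    by (simp add: algebra_simps)
  also have "cdf D t * cdf D t ^ (i - 1) = cdf D t ^ i"
    using i by (simp add: power_eq_if)
  finally show ?thesis unfolding eq s_def .
qed

lemma (in prob_space) prob_order_stat_le:
  fixes X :: "nat \<Rightarrow> 'a \<Rightarrow> real"
  assumes ind: "indep_vars (\<lambda>_. borel) X {1..}"
    and D: "\<And>j. 1 \<le> j \<Longrightarrow> distr M borel (X j) = D"
    and i: "1 \<le> i" "i \<le> m"
  shows "prob {\<omega> \<in> space M. order_stat X i m \<omega> \<le> t}
    = (\<Sum>j=i..m. real (m choose j) * cdf D t ^ j * (1 - cdf D t) ^ (m - j))"
proof -
  have X: "random_variable borel (X j)" if "1 \<le> j" for j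
    using ind that unfolding indep_vars_def by auto
  interpret D: prob_space D
    using D[of 1] prob_space_distr[of "X 1" borel] X by simp
  have [measurable]: "count_le X m u \<in> measurable M (count_space UNIV)" for u
    by (intro measurable_count_le X)
  \<comment> \<open>The trivial constraint \<open>UNIV\<close> and the repeated threshold give the
    event the shape of \<open>prob_count_le\<close>.\<close>
  define E where "E j = {\<omega> \<in> space M. X (Suc m) \<omega> \<in> UNIV \<and> count_le X m t \<omega> = j \<and> count_le X m t \<omega> = j}" for j
  have E[measurable]: "E s \<in> events" for s unfolding E_def by measurable
  have le: "count_le X m t \<omega> \<le> m" for \<omega>
    unfolding count_le_def by (rule order_trans[OF card_mono[of "{1..m}"]]) auto
  have "{\<omega> \<in> space M. order_stat X i m \<omega> \<le> t} = (\<Union>j\<in>{i..m}. E j)"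
    unfolding E_def order_stat_le_iff[OF i] using le by auto
  also have "prob \<dots> = (\<Sum>j\<in>{i..m}. prob (E j))"
    by (intro finite_measure_finite_Union) (auto simp: disjoint_family_on_def E_def)
  also have "\<dots> = (\<Sum>j=i..m. real (m choose j) * cdf D t ^ j * (1 - cdf D t) ^ (m - j))"
  proof (rule sum.cong[OF refl])
    fix j
    have "measure D UNIV = 1" using D.prob_space D[of 1] by auto
    then show "prob (E j) = real (m choose j) * cdf D t ^ j * (1 - cdf D t) ^ (m - j)"
      unfolding E_def using prob_count_le[OF ind D, of UNIV t t m j] by simp
  qed
  finally show ?thesis .
qed

section \<open>Mean gap between the two order statistics\<close>

text \<open>The gap Z - W is the length of the set of t with W \<le> t < Z, and the order of
  integration is exchanged. Nonnegative integrals are used because finiteness is only established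
  later.\<close>

lemma (in prob_space) nn_integral_diff_between:
  assumes [measurable]: "Z \<in> borel_measurable M" "W \<in> borel_measurable M"
    and le: "\<And>\<omega>. \<omega> \<in> space M \<Longrightarrow> W \<omega> \<le> Z \<omega>"
  shows "(\<integral>\<^sup>+\<omega>. ennreal (Z \<omega> - W \<omega>) * indicator {x<..y} (Z \<omega>) \<partial>M)
    = (\<integral>\<^sup>+t. emeasure M {\<omega> \<in> space M. W \<omega> \<le> t \<and> t < Z \<omega> \<and> x < Z \<omega> \<and> Z \<omega> \<le> (y::real)} \<partial>lborel)"
proof -
  interpret pair_sigma_finite M lborel ..
  define g :: "'a \<Rightarrow> real \<Rightarrow> ennreal" where
    "g \<omega> t = (if W \<omega> \<le> t \<and> t < Z \<omega> \<and> x < Z \<omega> \<and> Z \<omega> \<le> y then 1 else 0)" for \<omega> t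
  have [measurable]: "case_prod g \<in> borel_measurable (M \<Otimes>\<^sub>M lborel)"
    unfolding g_def by measurable
  have "(\<integral>\<^sup>+\<omega>. ennreal (Z \<omega> - W \<omega>) * indicator {x<..y} (Z \<omega>) \<partial>M) = (\<integral>\<^sup>+\<omega>. \<integral>\<^sup>+t. g \<omega> t \<partial>lborel \<partial>M)"
  proof (rule nn_integral_cong)
    fix \<omega> assume "\<omega> \<in> space M"
    have "(\<integral>\<^sup>+t. g \<omega> t \<partial>lborel) = (\<integral>\<^sup>+t. indicator {x<..y} (Z \<omega>) * indicator {W \<omega>..<Z \<omega>} t \<partial>lborel)"
      by (rule nn_integral_cong) (auto simp: g_def indicator_def)
    also have "\<dots> = indicator {x<..y} (Z \<omega>) * ennreal (Z \<omega> - W \<omega>)"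
      using le[OF \<open>\<omega> \<in> space M\<close>] by (subst nn_integral_cmult) auto
    finally show "ennreal (Z \<omega> - W \<omega>) * indicator {x<..y} (Z \<omega>) = (\<integral>\<^sup>+t. g \<omega> t \<partial>lborel)"
      by (simp add: mult.commute)
  qed
  also have "\<dots> = (\<integral>\<^sup>+t. \<integral>\<^sup>+\<omega>. g \<omega> t \<partial>M \<partial>lborel)"
    by (rule Fubini'[symmetric]) measurable
  also have "\<dots> = (\<integral>\<^sup>+t. emeasure M {\<omega> \<in> space M. W \<omega> \<le> t \<and> t < Z \<omega> \<and> x < Z \<omega> \<and> Z \<omega> \<le> y} \<partial>lborel)"
  proof (rule nn_integral_cong)
    fix t
    have "(\<integral>\<^sup>+\<omega>. g \<omega> t \<partial>M) = (\<integral>\<^sup>+\<omega>. indicator {\<omega> \<in> space M. W \<omega> \<le> t \<and> t < Z \<omega> \<and> x < Z \<omega> \<and> Z \<omega> \<le> y} \<omega> \<partial>M)"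
      by (rule nn_integral_cong) (auto simp: g_def indicator_def)
    then show "(\<integral>\<^sup>+\<omega>. g \<omega> t \<partial>M) = emeasure M {\<omega> \<in> space M. W \<omega> \<le> t \<and> t < Z \<omega> \<and> x < Z \<omega> \<and> Z \<omega> \<le> y}"
      by simp
  qed
  finally show ?thesis .
qed

text \<open>For t \<le> x the probability under the integral is exactly K F(t)^i, for x < t < y it
  lies between 0 and K F(t)^i, and for t \<ge> y the event is empty. The two bounds thus differ only
  through t in (x, y], which disappears as y tends to x.\<close>

lemma (in prob_space) order_stat_gap_bounds:
  fixes X :: "nat \<Rightarrow> 'a \<Rightarrow> real"
  assumes ind: "indep_vars (\<lambda>_. borel) X {1..}"
    and D: "\<And>j. 1 \<le> j \<Longrightarrow> distr M borel (X j) = D"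
    and i: "1 \<le> i" "i \<le> m" and xy: "x < y"
  defines "K \<equiv> real (m choose (i - 1)) * ((1 - cdf D x) ^ (m - (i - 1)) - (1 - cdf D y) ^ (m - (i - 1)))"
    and "I \<equiv> (\<integral>\<^sup>+\<omega>. ennreal (order_stat X i m \<omega> - order_stat X i (Suc m) \<omega>) *
        indicator {x<..y} (order_stat X i m \<omega>) \<partial>M)"
  shows "ennreal K * (\<integral>\<^sup>+t. ennreal (cdf D t ^ i) * indicator {..x} t \<partial>lborel) \<le> I"
    and "I \<le> ennreal K * (\<integral>\<^sup>+t. ennreal (cdf D t ^ i) * indicator {..y} t \<partial>lborel)"
proof -
  have X: "random_variable borel (X j)" if "1 \<le> j" for j
    using ind that unfolding indep_vars_def by auto
  interpret D: real_distribution D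
    using D[of 1] real_distribution_distr[OF X[of 1]] by simp
  define P where "P t = {\<omega> \<in> space M. order_stat X i (Suc m) \<omega> \<le> t \<and> t < order_stat X i m \<omega> \<and>
      x < order_stat X i m \<omega> \<and> order_stat X i m \<omega> \<le> y}" for t
  have I: "I = (\<integral>\<^sup>+t. emeasure M (P t) \<partial>lborel)"
    unfolding I_def P_def using i
    by (intro nn_integral_diff_between borel_measurable_order_stat X order_stat_Suc_le) auto
  have [measurable]: "cdf D \<in> borel_measurable borel"
    by (intro borel_measurable_mono monoI D.cdf_nondecreasing)
  have F01: "0 \<le> cdf D t" "cdf D t \<le> 1" for t
    using D.cdf_nonneg D.cdf_bounded_prob by auto
  have Fmono: "s \<le> t \<Longrightarrow> cdf D s \<le> cdf D t" for s t by (rule D.cdf_nondecreasing)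
  have K: "0 \<le> K" unfolding K_def
    by (intro mult_nonneg_nonneg) (auto intro!: power_mono Fmono F01 simp: xy less_imp_le)
  have P: "emeasure M (P t) = ennreal (real (m choose (i - 1)) * cdf D t ^ i *
      ((1 - cdf D (max t x)) ^ (m - (i - 1)) - (1 - cdf D y) ^ (m - (i - 1))))" if "t < y" for t
    unfolding P_def emeasure_eq_measure using prob_order_stat_between[OF ind D i that xy] by simp
  show "ennreal K * (\<integral>\<^sup>+t. ennreal (cdf D t ^ i) * indicator {..x} t \<partial>lborel) \<le> I"
  proof -
    have "ennreal K * (\<integral>\<^sup>+t. ennreal (cdf D t ^ i) * indicator {..x} t \<partial>lborel)
      = (\<integral>\<^sup>+t. ennreal K * (ennreal (cdf D t ^ i) * indicator {..x} t) \<partial>lborel)"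
      by (rule nn_integral_cmult[symmetric]) measurable
    also have "\<dots> \<le> I" unfolding I
    proof (rule nn_integral_mono)
      fix t
      show "ennreal K * (ennreal (cdf D t ^ i) * indicator {..x} t) \<le> emeasure M (P t)"
      proof (cases "t \<le> x")
        case True
        then have "emeasure M (P t) = ennreal (K * cdf D t ^ i)"
          using P[of t] xy by (simp add: K_def max_def mult_ac)
        then show ?thesis using True K F01 by (simp add: ennreal_mult)
      qed simp
    qed
    finally show ?thesis .
  qed
  show "I \<le> ennreal K * (\<integral>\<^sup>+t. ennreal (cdf D t ^ i) * indicator {..y} t \<partial>lborel)"
  proof -
    have "I \<le> (\<integral>\<^sup>+t. ennreal K * (ennreal (cdf D t ^ i) * indicator {..y} t) \<partial>lborel)" unfolding I
    proof (rule nn_integral_mono)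
      fix t
      show "emeasure M (P t) \<le> ennreal K * (ennreal (cdf D t ^ i) * indicator {..y} t)"
      proof (cases "t < y")
        case True
        have "(1 - cdf D (max t x)) ^ (m - (i - 1)) \<le> (1 - cdf D x) ^ (m - (i - 1))"
          by (intro power_mono) (auto intro!: Fmono F01)
        then have "real (m choose (i - 1)) * cdf D t ^ i *
            ((1 - cdf D (max t x)) ^ (m - (i - 1)) - (1 - cdf D y) ^ (m - (i - 1)))
          \<le> real (m choose (i - 1)) * cdf D t ^ i *
            ((1 - cdf D x) ^ (m - (i - 1)) - (1 - cdf D y) ^ (m - (i - 1)))"
          by (intro mult_left_mono) (auto intro!: mult_nonneg_nonneg zero_le_power F01)
        also have "\<dots> = K * cdf D t ^ i" by (simp add: K_def)
        finally have "emeasure M (P t) \<le> ennreal (K * cdf D t ^ i)"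
          unfolding P[OF True] by (rule ennreal_leI)
        then show ?thesis using True K F01 by (simp add: ennreal_mult)
      next
        case False
        then have "P t = {}" unfolding P_def by auto
        then show ?thesis by simp
      qed
    qed
    also have "\<dots> = ennreal K * (\<integral>\<^sup>+t. ennreal (cdf D t ^ i) * indicator {..y} t \<partial>lborel)"
      by (rule nn_integral_cmult) measurable
    finally show ?thesis .
  qed
qed

section \<open>Real analysis\<close>

text \<open>The derivatives of the summands telescope, which is proved by downward induction from k
  = m - 1, where the only term is u^m. With k = i - 1 this differentiates the law of the i-th order
  statistic with respect to u = F.\<close>

lemma has_real_derivative_binomial_tail:
  fixes u :: real
  assumes "k < m"
  shows "((\<lambda>u. \<Sum>j=Suc k..m. real (m choose j) * u ^ j * (1 - u) ^ (m - j)) has_real_derivative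
      real (m choose k) * real (m - k) * u ^ k * (1 - u) ^ (m - Suc k)) (at u)"
proof -
  have "k \<le> m - 1" using assms by simp
  then show ?thesis
  proof (induction k rule: inc_induct)
    case base
    obtain n where m: "m = Suc n" using assms by (cases m) auto
    show ?case unfolding m
      using DERIV_pow[of "Suc n" u] by simp
  next
    case (step k)
    obtain d where m: "m = Suc (Suc k) + d"
      using step.hyps less_iff_Suc_add[of "Suc k" m] by auto
    \<comment> \<open>By this identity the positive part of the derivative of the new term is the
      claimed value; its negative part cancels the derivative of the remaining tail.\<close>
    have coef: "real (m choose k) * real (m - k) = real (Suc k) * real (m choose Suc k)"
    proof -
      have "(m - k) * (m choose k) = Suc k * (m choose Suc k)"
        by (simp only: binomial_absorb_comp binomial_absorption)
      then have "real ((m - k) * (m choose k)) = real (Suc k * (m choose Suc k))" by (rule arg_cong)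
      then show ?thesis by (simp only: of_nat_mult mult.commute)
    qed
    define c where "c = real (m choose Suc k)"
    have d: "m - Suc k = Suc d" "m - Suc (Suc k) = d" using m by simp_all
    have term_deriv: "((\<lambda>u. c * u ^ Suc k * (1 - u) ^ Suc d) has_real_derivative
        c * (real (Suc k) * u ^ k * (1 - u) ^ Suc d - u ^ Suc k * (real (Suc d) * (1 - u) ^ d))) (at u)"
      by (rule derivative_eq_intros refl)+ (simp add: algebra_simps)
    have "((\<lambda>u. c * u ^ Suc k * (1 - u) ^ Suc d +
        (\<Sum>j=Suc (Suc k)..m. real (m choose j) * u ^ j * (1 - u) ^ (m - j))) has_real_derivative
        c * (real (Suc k) * u ^ k * (1 - u) ^ Suc d - u ^ Suc k * (real (Suc d) * (1 - u) ^ d)) +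
        c * real (Suc d) * u ^ Suc k * (1 - u) ^ d) (at u)"
      by (rule DERIV_add[OF term_deriv step.IH[unfolded d, folded c_def]])
    also have "(\<lambda>u. c * u ^ Suc k * (1 - u) ^ Suc d +
        (\<Sum>j=Suc (Suc k)..m. real (m choose j) * u ^ j * (1 - u) ^ (m - j)))
      = (\<lambda>u. \<Sum>j=Suc k..m. real (m choose j) * u ^ j * (1 - u) ^ (m - j))"
    proof
      fix u :: real
      have "Suc k \<le> m" using m by simp
      from sum.atLeast_Suc_atMost[OF this, of "\<lambda>j. real (m choose j) * u ^ j * (1 - u) ^ (m - j)"]
      show "c * u ^ Suc k * (1 - u) ^ Suc d +
          (\<Sum>j=Suc (Suc k)..m. real (m choose j) * u ^ j * (1 - u) ^ (m - j))
        = (\<Sum>j=Suc k..m. real (m choose j) * u ^ j * (1 - u) ^ (m - j))"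
        unfolding c_def d by (rule sym)
    qed
    also have "c * (real (Suc k) * u ^ k * (1 - u) ^ Suc d - u ^ Suc k * (real (Suc d) * (1 - u) ^ d)) +
        c * real (Suc d) * u ^ Suc k * (1 - u) ^ d = (real (Suc k) * c) * u ^ k * (1 - u) ^ (m - Suc k)"
      unfolding d by (simp only: right_diff_distrib mult_ac diff_add_cancel)
    finally show ?case unfolding coef c_def .
  qed
qed

text \<open>Integrability up to one point c extends to every upper limit, since g is continuous and
  hence integrable on compact intervals.\<close>

lemma has_real_derivative_lower_integral:
  fixes g :: "real \<Rightarrow> real"
  assumes cont: "continuous_on UNIV g" and int: "set_integrable lborel {..c} g"
  shows "set_integrable lborel {..x} g"
    and "((\<lambda>x. LINT t:{..x}|lborel. g t) has_real_derivative g x) (at x)"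
proof -
  have ci: "set_integrable lborel {u..v} g" for u v
    using cont by (intro borel_integrable_atLeastAtMost') (auto intro: continuous_on_subset)
  have all: "set_integrable lborel {..x} g" for x
  proof -
    have "set_integrable lborel ({..c} \<union> {c..x}) g"
      by (intro set_integrable_Un int ci) auto
    then show ?thesis by (rule set_integrable_subset) auto
  qed
  show "set_integrable lborel {..x} g" by (rule all)
  \<comment> \<open>A base point strictly below x: the integral up to it is constant, and the rest
    is an integral over a compact interval having x as an end that can move both ways.\<close>
  define c' where "c' = x - 1"
  have eq: "(LINT t:{..y}|lborel. g t) = (LINT t:{..c'}|lborel. g t) + integral {c'..y} g" if "c' \<le> y" for y
  proof -
    have split: "{..y} = {..c'} \<union> {c'<..y}" using that by auto
    have int': "set_integrable lborel {c'<..y} g"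
      by (rule set_integrable_subset[OF ci[of c' y]]) auto
    have "(LINT t:{..y}|lborel. g t) = (LINT t:{..c'}|lborel. g t) + (LINT t:{c'<..y}|lborel. g t)"
      unfolding split by (rule set_integral_Un[OF _ all int']) auto
    also have "(LINT t:{c'<..y}|lborel. g t) = (LINT t:{c'..y}|lborel. g t)"
      unfolding set_lebesgue_integral_def
    proof (rule integral_cong_AE)
      show "AE t in lborel. indicat_real {c'<..y} t *\<^sub>R g t = indicat_real {c'..y} t *\<^sub>R g t"
        using AE_lborel_singleton[of c'] by eventually_elim (auto simp: indicator_def)
    qed (use int' ci[of c' y] in \<open>auto simp only: set_integrable_def integrable_iff_bounded\<close>)
    also have "\<dots> = integral {c'..y} g"
      by (rule set_borel_integral_eq_integral(2)[OF ci])
    finally show ?thesis .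
  qed
  have "((\<lambda>y. integral {c'..y} g) has_real_derivative g x) (at x within {c'..x+1})"
    using cont by (intro integral_has_real_derivative) (auto simp: c'_def intro: continuous_on_subset)
  then have "((\<lambda>y. integral {c'..y} g) has_real_derivative g x) (at x)"
    by (subst (asm) at_within_interior) (auto simp: c'_def)
  then have der: "((\<lambda>y. (LINT t:{..c'}|lborel. g t) + integral {c'..y} g) has_real_derivative g x) (at x)"
    by (auto intro!: derivative_eq_intros)
  have "\<forall>\<^sub>F y in nhds x. y \<in> {c'<..}"
    by (intro eventually_nhds_in_open) (auto simp: c'_def)
  then have ev: "\<forall>\<^sub>F y in nhds x. (LINT t:{..c'}|lborel. g t) + integral {c'..y} g = (LINT t:{..y}|lborel. g t)"
    by eventually_elim (rule eq[symmetric], simp)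
  show "((\<lambda>x. LINT t:{..x}|lborel. g t) has_real_derivative g x) (at x)"
    by (rule DERIV_cong_ev[OF refl ev refl, THEN iffD1, OF der])
qed

text \<open>\<open>T\<close> stands for the mean gap and \<open>P\<close> for the probability of the
  thin slab. After division by F(y) - F(x), the sandwich gives \<open>T\<close> the limit \<kappa>
  g, while closeness to c P gives it the limit c p.\<close>

lemma limit_quotients_eq:
  fixes T P K G F :: "real \<Rightarrow> real"
  assumes F: "\<forall>\<^sub>F y in at_right x. F x < F y"
    and K: "((\<lambda>y. K y / (F y - F x)) \<longlongrightarrow> \<kappa>) (at_right x)"
    and P: "((\<lambda>y. P y / (F y - F x)) \<longlongrightarrow> p) (at_right x)"
    and G: "(G \<longlongrightarrow> g) (at_right x)"
    and T: "\<forall>\<^sub>F y in at_right x. K y * g \<le> T y \<and> T y \<le> K y * G y"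
    and TP: "\<And>\<epsilon>. 0 < \<epsilon> \<Longrightarrow> \<forall>\<^sub>F y in at_right x. \<bar>T y - c * P y\<bar> \<le> \<epsilon> * P y"
  shows "\<kappa> * g = c * p"
proof (rule ccontr)
  assume ne: "\<kappa> * g \<noteq> c * p"
  have Tl: "((\<lambda>y. T y / (F y - F x)) \<longlongrightarrow> \<kappa> * g) (at_right x)"
  proof (rule tendsto_sandwich)
    show "\<forall>\<^sub>F y in at_right x. (K y / (F y - F x)) * g \<le> T y / (F y - F x)"
      using F T by eventually_elim (simp add: divide_right_mono)
    show "\<forall>\<^sub>F y in at_right x. T y / (F y - F x) \<le> (K y / (F y - F x)) * G y"
      using F T by eventually_elim (simp add: divide_right_mono)
  qed (intro tendsto_intros K G)+
  have le: "\<bar>\<kappa> * g - c * p\<bar> \<le> \<epsilon> * p" if "0 < \<epsilon>" for \<epsilon>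
  proof (rule tendsto_le)
    show "((\<lambda>y. \<epsilon> * (P y / (F y - F x))) \<longlongrightarrow> \<epsilon> * p) (at_right x)"
      by (intro tendsto_intros P)
    show "((\<lambda>y. \<bar>T y / (F y - F x) - c * (P y / (F y - F x))\<bar>) \<longlongrightarrow> \<bar>\<kappa> * g - c * p\<bar>) (at_right x)"
      by (intro tendsto_intros P Tl)
    show "\<forall>\<^sub>F y in at_right x. \<bar>T y / (F y - F x) - c * (P y / (F y - F x))\<bar> \<le> \<epsilon> * (P y / (F y - F x))"
      using F TP[OF that]
    proof eventually_elim
      case (elim y)
      have "T y / (F y - F x) - c * (P y / (F y - F x)) = (T y - c * P y) / (F y - F x)"
        by (simp add: diff_divide_distrib)
      then show ?case using elim by (simp add: divide_right_mono)
    qed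
  qed simp
  \<comment> \<open>The bound with \<epsilon> = 1 forces p > 0; then \<epsilon> is chosen so that
    the difference is at most half of itself.\<close>
  have pos: "0 < \<bar>\<kappa> * g - c * p\<bar>" using ne by simp
  then have p: "0 < p" using le[of 1] by simp
  have "\<bar>\<kappa> * g - c * p\<bar> \<le> \<bar>\<kappa> * g - c * p\<bar> / (2 * p) * p"
    using pos p by (intro le) simp
  then show False using pos p by simp
qed

text \<open>Left neighbourhoods are taken in the extended reals so that finite and infinite b are
  treated alike; this brings them back to real points.\<close>

lemma eventually_at_left_ereal_real:
  assumes "ereal x0 < b" "\<And>t. x0 < t \<Longrightarrow> ereal t < b \<Longrightarrow> P t"
  shows "\<forall>\<^sub>F z in at_left b. P (real_of_ereal z)"
  unfolding eventually_at_left[OF assms(1)]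
proof (intro exI[of _ "ereal x0"] conjI allI impI assms(1))
  fix z assume "ereal x0 < z" "z < b"
  then show "P (real_of_ereal z)" using assms(2) by (cases z) auto
qed

section \<open>Solution of the integral equation\<close>

lemma solve_integral_equation:
  fixes F G h :: "real \<Rightarrow> real" and a b :: ereal and i :: nat
  assumes ab: "a < b" and i: "2 \<le> i"
    and F: "\<And>x. x \<in> einterval a b \<Longrightarrow> 0 < F x" "\<And>x. isCont F x"
      "((F \<circ> real_of_ereal) \<longlongrightarrow> 1) (at_left b)"
    and G: "\<And>x. x \<in> einterval a b \<Longrightarrow> 0 < G x" "\<And>x. (G has_real_derivative F x ^ i) (at x)" "mono G"
    and h: "\<And>x. x \<in> einterval a b \<Longrightarrow> h x * F x ^ (i - 1) = G x"
  shows "(\<forall>x\<in>einterval a b. 0 < h x) \<and>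
    (\<exists>L::ereal. 0 < L \<and>
      ((\<lambda>x. ereal (h (real_of_ereal x))) \<longlongrightarrow> L) (at_left b) \<and>
      (\<forall>x\<in>einterval a b.
        interval_lebesgue_integrable lborel (ereal x) b
          (\<lambda>t. h t powr (- (real i / (real i - 1)))) \<and>
        F x = h x powr (- (1 / (real i - 1))) /
          (neg_powr L (1 / (real i - 1))
            + 1 / (real i - 1) *
              (LBINT t=ereal x..b. h t powr (- (real i / (real i - 1)))))))"
proof -
  define n where "n = real i - 1"
  have n: "n > 0" "real (i - 1) = n" "real i = n + 1" using i by (auto simp: n_def)
  have ht: "h x = G x / F x ^ (i - 1)" if "x \<in> einterval a b" for x
    using h[OF that] F(1)[OF that] by (simp add: field_simps)
  have hpos: "0 < h x" if "x \<in> einterval a b" for x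
    using ht[OF that] F(1)[OF that] G(1)[OF that] by simp
  have hpow: "h x powr (- (s / n)) = G x powr (- (s / n)) * F x powr s"
    if "x \<in> einterval a b" for x s
  proof -
    have "h x powr (- (s / n)) = G x powr (- (s / n)) / (F x ^ (i - 1)) powr (- (s / n))"
      using ht[OF that] F(1)[OF that] G(1)[OF that] by (simp add: powr_divide)
    also have "F x ^ (i - 1) = F x powr n"
      using F(1)[OF that] n by (simp add: powr_realpow[symmetric])
    also have "(F x powr n) powr (- (s / n)) = F x powr (- s)"
      using n by (simp add: powr_powr)
    finally show ?thesis by (simp add: powr_minus divide_simps)
  qed
  obtain x0 where x0: "x0 \<in> einterval a b"
    using ereal_dense2[OF ab] by (auto simp: einterval_iff)
  have x0b: "ereal x0 < b" using x0 by (simp add: einterval_iff)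
  have ev: "\<forall>\<^sub>F z in at_left b. real_of_ereal z \<in> einterval a b"
    by (rule eventually_at_left_ereal_real[OF x0b])
       (use x0 in \<open>auto simp: einterval_iff intro: less_trans\<close>)
  \<comment> \<open>G is monotone, so its limit at b is its supremum over the interval; h inherits
    this limit because F tends to 1.\<close>
  define L where "L = (SUP x\<in>einterval a b. ereal (G x))"
  have L0: "0 < L"
    using G(1)[OF x0] SUP_upper[OF x0, of "\<lambda>x. ereal (G x)"] unfolding L_def
    by (metis ereal_less(2) less_le_trans)
  have GL: "((\<lambda>z. ereal (G (real_of_ereal z))) \<longlongrightarrow> L) (at_left b)"
  proof (rule order_tendstoI)
    fix l assume "l < L"
    then obtain y where y: "y \<in> einterval a b" "l < ereal (G y)"
      unfolding L_def by (auto simp: less_SUP_iff)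
    have "ereal y < b" using y by (simp add: einterval_iff)
    then show "\<forall>\<^sub>F z in at_left b. l < ereal (G (real_of_ereal z))"
    proof (rule eventually_at_left_ereal_real)
      fix t assume "y < t"
      then have "G y \<le> G t" using G(3) by (simp add: monoD)
      then show "l < ereal (G t)" using y(2) by (meson ereal_less_eq(3) less_le_trans)
    qed
  next
    fix l assume "L < l"
    show "\<forall>\<^sub>F z in at_left b. ereal (G (real_of_ereal z)) < l"
      using ev
    proof eventually_elim
      case (elim z)
      then have "ereal (G (real_of_ereal z)) \<le> L" unfolding L_def by (rule SUP_upper)
      then show ?case using \<open>L < l\<close> by simp
    qed
  qed
  have hL: "((\<lambda>z. ereal (h (real_of_ereal z))) \<longlongrightarrow> L) (at_left b)"
  proof -
    have "((\<lambda>z. 1 / F (real_of_ereal z) ^ (i - 1)) \<longlongrightarrow> 1 / 1 ^ (i - 1)) (at_left b)"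
      using F(3) by (intro tendsto_intros) (auto simp: comp_def)
    then have "((\<lambda>z. ereal (1 / F (real_of_ereal z) ^ (i - 1))) \<longlongrightarrow> 1) (at_left b)"
      by (simp add: one_ereal_def)
    from tendsto_mult_ereal_pos[OF GL this L0]
    have "((\<lambda>z. ereal (G (real_of_ereal z)) * ereal (1 / F (real_of_ereal z) ^ (i - 1))) \<longlongrightarrow> L) (at_left b)"
      by simp
    then show ?thesis
      by (rule Lim_transform_eventually) (use ev in eventually_elim, simp add: ht)
  qed
  \<comment> \<open>The convention in \<open>neg_powr\<close> is the actual limit here: if G grows
    without bound, its negative power tends to 0.\<close>
  have GB: "((\<lambda>z. G (real_of_ereal z) powr (- (1 / n))) \<longlongrightarrow> neg_powr L (1 / n)) (at_left b)"
  proof (cases L)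
    case (real l)
    have "((\<lambda>z. G (real_of_ereal z)) \<longlongrightarrow> l) (at_left b)"
      using GL unfolding real by simp
    then have "((\<lambda>z. G (real_of_ereal z) powr (- (1 / n))) \<longlongrightarrow> l powr (- (1 / n))) (at_left b)"
      using L0 real by (intro tendsto_intros) auto
    then show ?thesis using real by (simp add: neg_powr_def)
  next
    case PInf
    have "filterlim (\<lambda>z. G (real_of_ereal z)) at_top (at_left b)"
      using GL unfolding PInf using ereal_tendsto_simps2(2)[of "\<lambda>z. G (real_of_ereal z)" "at_left b"]
      by (simp add: comp_def)
    then have "((\<lambda>z. G (real_of_ereal z) powr (- (1 / n))) \<longlongrightarrow> 0) (at_left b)"
      using n by (intro tendsto_neg_powr) auto
    then show ?thesis using PInf by (simp add: neg_powr_def)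
  qed (use L0 in auto)
  have main: "interval_lebesgue_integrable lborel (ereal x) b (\<lambda>t. h t powr (- (real i / n))) \<and>
      F x = h x powr (- (1 / n)) / (neg_powr L (1 / n)
        + 1 / n * (LBINT t=ereal x..b. h t powr (- (real i / n))))" if x: "x \<in> einterval a b" for x
  proof -
    \<comment> \<open>An antiderivative of the integrand: - 1/n - 1 = - i/n, so the chain rule
      yields G^(-i/n) F^i, which is h^(-i/n) by \<open>hpow\<close>.\<close>
    define \<Phi> where "\<Phi> t = - n * G t powr (- (1 / n))" for t
    have xb: "ereal x < b" using x by (simp add: einterval_iff)
    have sub: "t \<in> einterval a b" if "ereal x < ereal t" "ereal t < b" for t
      using that x by (auto simp: einterval_iff intro: less_trans)
    have der: "(\<Phi> has_real_derivative h t powr (- (real i / n))) (at t)" if "t \<in> einterval a b" for t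
    proof -
      have "(\<Phi> has_real_derivative - n * (- (1 / n) * G t powr (- (1 / n) - 1) * F t ^ i)) (at t)"
        unfolding \<Phi>_def
        by (rule DERIV_cmult[OF DERIV_chain2[OF has_real_derivative_powr[OF G(1)[OF that]] G(2)]])
      also have "- (1 / n) - 1 = - (real i / n)"
        using n by (simp add: field_simps)
      also have "F t ^ i = F t powr (real i)"
        using F(1)[OF that] by (simp add: powr_realpow)
      also have "- n * (- (1 / n) * G t powr (- (real i / n)) * F t powr (real i)) = G t powr (- (real i / n)) * F t powr (real i)"
        using n(1) by simp
      finally show ?thesis unfolding hpow[OF that] .
    qed
    have ca: "isCont G t" for t using G(2) by (rule DERIV_isCont)
    have cont: "isCont (\<lambda>t. h t powr (- (real i / n))) t" if "t \<in> einterval a b" for t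
    proof -
      have c: "isCont (\<lambda>t. G t powr (- (real i / n)) * F t powr (real i)) t"
        using F(1)[OF that] G(1)[OF that] by (intro continuous_intros ca F(2)) auto
      have "\<forall>\<^sub>F s in nhds t. s \<in> einterval a b"
        using that by (intro eventually_nhds_in_open) auto
      then have ev: "\<forall>\<^sub>F s in nhds t. G s powr (- (real i / n)) * F s powr (real i) = h s powr (- (real i / n))"
        by eventually_elim (simp add: hpow)
      show ?thesis by (rule isCont_cong[OF ev, THEN iffD1, OF c])
    qed
    have A: "((\<Phi> \<circ> real_of_ereal) \<longlongrightarrow> \<Phi> x) (at_right (ereal x))"
      unfolding ereal_tendsto_simps
      using DERIV_isCont[OF der[OF x]] unfolding isCont_def by (rule filterlim_mono) (auto simp: at_le)
    have B: "((\<Phi> \<circ> real_of_ereal) \<longlongrightarrow> - n * neg_powr L (1 / n)) (at_left b)"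
      unfolding comp_def \<Phi>_def by (intro tendsto_intros GB)
    \<comment> \<open>For a nonnegative integrand, finite limits of \<Phi> at both ends yield
      integrability up to b together with the value of the integral.\<close>
    note FTC = interval_integral_FTC_nonneg[OF xb der cont _ A B]
    have "set_integrable lborel (einterval (ereal x) b) (\<lambda>t. h t powr (- (real i / n)))"
      by (rule FTC(1)) (auto intro: sub)
    moreover have "(LBINT t=ereal x..b. h t powr (- (real i / n))) = - n * neg_powr L (1 / n) - \<Phi> x"
      by (rule FTC(2)) (auto intro: sub)
    then have "neg_powr L (1 / n) + 1 / n * (LBINT t=ereal x..b. h t powr (- (real i / n))) = G x powr (- (1 / n))"
      using n by (simp add: \<Phi>_def field_simps)
    moreover have "h x powr (- (1 / n)) = G x powr (- (1 / n)) * F x"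
      using hpow[OF x, of 1] F(1)[OF x] by simp
    ultimately show ?thesis
      using xb G(1)[OF x] by (simp add: interval_lebesgue_integrable_def less_imp_le)
  qed
  show ?thesis unfolding n_def[symmetric] using hpos L0 hL main by blast
qed

section \<open>The regression equation\<close>

text \<open>The event x < Z \<le> y belongs to the sigma-algebra of Z, so on it W may be replaced by
  its conditional expectation, and Z minus that is h(Z), which is within \<epsilon> of c.\<close>

lemma (in prob_space) cond_exp_gap:
  fixes Z W :: "'a \<Rightarrow> real" and h :: "real \<Rightarrow> real"
  assumes Z[measurable]: "Z \<in> borel_measurable M" and W: "integrable M W"
    and le: "\<And>\<omega>. \<omega> \<in> space M \<Longrightarrow> W \<omega> \<le> Z \<omega>"
    and ce: "AE \<omega> in M. real_cond_exp M (vimage_algebra (space M) Z borel) W \<omega> = Z \<omega> - h (Z \<omega>)"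
    and h: "\<And>z. z \<in> {x<..y} \<Longrightarrow> \<bar>h z - c\<bar> \<le> \<epsilon>"
  defines "I \<equiv> (\<integral>\<^sup>+\<omega>. ennreal (Z \<omega> - W \<omega>) * indicator {x<..y} (Z \<omega>) \<partial>M)"
    and "p \<equiv> prob {\<omega> \<in> space M. x < Z \<omega> \<and> Z \<omega> \<le> y}"
  shows "I < \<infinity>" and "\<bar>enn2real I - c * p\<bar> \<le> \<epsilon> * p"
proof -
  let ?V = "vimage_algebra (space M) Z borel"
  define A where "A = {\<omega> \<in> space M. x < Z \<omega> \<and> Z \<omega> \<le> y}"
  have A[measurable]: "A \<in> events" unfolding A_def by measurable
  have "A = Z -` {x<..y} \<inter> space M" unfolding A_def by auto
  then have AV: "A \<in> sets ?V" by (auto intro: in_vimage_algebra)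
  have "subalgebra M ?V"
    unfolding subalgebra_def using measurable_sets[OF Z] by (auto simp: sets_vimage_algebra2)
  then interpret fs: finite_measure_subalgebra M ?V by unfold_locales
  define E where "E = real_cond_exp M ?V W"
  have E: "integrable M E" unfolding E_def by (rule fs.real_cond_exp_int(1)[OF W])
  have sW: "set_integrable M A W" and sE: "set_integrable M A E"
    unfolding set_integrable_def by (intro integrable_mult_indicator A W E)+
  \<comment> \<open>On \<open>A\<close> the variable Z is bounded by its two thresholds; this is
    what makes the mean gap finite.\<close>
  have sZ: "set_integrable M A Z"
    unfolding set_integrable_def
    by (rule integrable_const_bound[where B="max \<bar>x\<bar> \<bar>y\<bar>"]) (auto simp: A_def indicator_def)
  have sd: "set_integrable M A (\<lambda>\<omega>. Z \<omega> - W \<omega>)" using sZ sW by (rule set_integral_diff)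
  have nonneg: "0 \<le> indicator A \<omega> *\<^sub>R (Z \<omega> - W \<omega>)" for \<omega>
    using le[of \<omega>] by (auto simp: A_def indicator_def)
  have "I = (\<integral>\<^sup>+\<omega>. ennreal (indicator A \<omega> *\<^sub>R (Z \<omega> - W \<omega>)) \<partial>M)"
    unfolding I_def by (rule nn_integral_cong) (auto simp: A_def indicator_def)
  also have "\<dots> = ennreal (LINT \<omega>:A|M. Z \<omega> - W \<omega>)"
    unfolding set_lebesgue_integral_def using nonneg sd[unfolded set_integrable_def]
    by (intro nn_integral_eq_integral) auto
  finally have I: "I = ennreal (LINT \<omega>:A|M. Z \<omega> - W \<omega>)" .
  then show "I < \<infinity>" by simp
  have "0 \<le> (LINT \<omega>:A|M. Z \<omega> - W \<omega>)"
    unfolding set_lebesgue_integral_def by (intro integral_nonneg_AE AE_I2 nonneg)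
  then have "enn2real I = (LINT \<omega>:A|M. Z \<omega> - W \<omega>)" using I by simp
  also have "\<dots> = (LINT \<omega>:A|M. Z \<omega>) - (LINT \<omega>:A|M. W \<omega>)"
    by (rule set_integral_diff(2)[OF sZ sW])
  also have "(LINT \<omega>:A|M. W \<omega>) = (LINT \<omega>:A|M. E \<omega>)"
    unfolding E_def by (rule fs.real_cond_exp_intA[OF W AV])
  \<comment> \<open>The integrand stays Z - E and is not rewritten as h(Z), since h is known only
    through its closeness to c on the slab, not as a measurable function.\<close>
  also have "(LINT \<omega>:A|M. Z \<omega>) - (LINT \<omega>:A|M. E \<omega>) = (LINT \<omega>:A|M. Z \<omega> - E \<omega>)"
    by (rule set_integral_diff(2)[OF sZ sE, symmetric])
  finally have eI: "enn2real I = (LINT \<omega>:A|M. Z \<omega> - E \<omega>)" .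
  have sc: "set_integrable M A (\<lambda>\<omega>. k)" for k :: real
    unfolding set_integrable_def by (intro integrable_mult_indicator A integrable_const)
  have ic: "(LINT \<omega>:A|M. k) = k * p" for k :: real
    unfolding set_lebesgue_integral_def p_def A_def[symmetric] by simp
  have sZE: "set_integrable M A (\<lambda>\<omega>. Z \<omega> - E \<omega>)" using sZ sE by (rule set_integral_diff)
  have ae: "AE \<omega> in M. \<omega> \<in> A \<longrightarrow> \<bar>Z \<omega> - E \<omega> - c\<bar> \<le> \<epsilon>"
    using ce unfolding E_def[symmetric]
    by eventually_elim (use h in \<open>auto simp: A_def\<close>)
  have "(LINT \<omega>:A|M. Z \<omega> - E \<omega>) \<le> (LINT \<omega>:A|M. c + \<epsilon>)"
    unfolding set_lebesgue_integral_def
    using sZE[unfolded set_integrable_def] sc[of "c + \<epsilon>", unfolded set_integrable_def]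
  proof (rule integral_mono_AE)
    show "AE \<omega> in M. indicator A \<omega> *\<^sub>R (Z \<omega> - E \<omega>) \<le> indicator A \<omega> *\<^sub>R (c + \<epsilon>)"
      using ae by eventually_elim (auto simp: indicator_def)
  qed
  moreover have "(LINT \<omega>:A|M. c - \<epsilon>) \<le> (LINT \<omega>:A|M. Z \<omega> - E \<omega>)"
    unfolding set_lebesgue_integral_def
    using sc[of "c - \<epsilon>", unfolded set_integrable_def] sZE[unfolded set_integrable_def]
  proof (rule integral_mono_AE)
    show "AE \<omega> in M. indicator A \<omega> *\<^sub>R (c - \<epsilon>) \<le> indicator A \<omega> *\<^sub>R (Z \<omega> - E \<omega>)"
      using ae by eventually_elim (auto simp: indicator_def)
  qed
  ultimately show "\<bar>enn2real I - c * p\<bar> \<le> \<epsilon> * p"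
    unfolding eI ic by (simp add: algebra_simps abs_le_iff)
qed

text \<open>Continuity holds because singletons are Lebesgue null. If F did not increase over (x,
  y], then f would vanish almost everywhere on a set of positive length where it is
  positive.\<close>

lemma (in prob_space) density_distr_cdf:
  fixes Y :: "'a \<Rightarrow> real"
  assumes d: "distributed M lborel Y (\<lambda>x. ennreal (f x))"
  defines "D \<equiv> distr M borel Y"
  shows "isCont (cdf D) x"
    and "x < y \<Longrightarrow> (\<And>t. t \<in> {x<..y} \<Longrightarrow> 0 < f t) \<Longrightarrow> cdf D x < cdf D y"
proof -
  have Y[measurable]: "Y \<in> borel_measurable M"
    using distributed_measurable[OF d] by simp
  have f[measurable]: "(\<lambda>x. ennreal (f x)) \<in> borel_measurable lborel"
    using distributed_borel_measurable[OF d] .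
  have "distr M lborel Y = distr M borel Y" by (rule distr_cong) auto
  then have D: "D = density lborel (\<lambda>x. ennreal (f x))"
    using distributed_distr_eq_density[OF d] unfolding D_def by simp
  interpret D: real_distribution D unfolding D_def by (rule real_distribution_distr[OF Y])
  have emD: "emeasure D A = (\<integral>\<^sup>+t. ennreal (f t) * indicator A t \<partial>lborel)" if "A \<in> sets borel" for A
    unfolding D using that by (subst emeasure_density) auto
  show "isCont (cdf D) x"
  proof -
    have "emeasure D {x} = 0"
    proof -
      have "(\<integral>\<^sup>+t. ennreal (f t) * indicator {x} t \<partial>lborel) = (\<integral>\<^sup>+(t::real). 0 \<partial>lborel)"
        using AE_lborel_singleton[of x]
        by (intro nn_integral_cong_AE) (auto elim!: eventually_mono simp: indicator_def)
      then show ?thesis using emD[of "{x}"] by simp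
    qed
    then show ?thesis unfolding D.isCont_cdf by (simp add: measure_def)
  qed
  show "cdf D x < cdf D y" if xy: "x < y" and pos: "\<And>t. t \<in> {x<..y} \<Longrightarrow> 0 < f t"
  proof (rule ccontr)
    assume "\<not> cdf D x < cdf D y"
    then have "measure D {x<..y} = 0"
      using D.cdf_diff_eq[OF xy] D.cdf_nondecreasing[of x y] xy by simp
    then have "(\<integral>\<^sup>+t. ennreal (f t) * indicator {x<..y} t \<partial>lborel) = 0"
      using emD[of "{x<..y}"] by (simp add: D.emeasure_eq_measure)
    then have "AE t in lborel. ennreal (f t) * indicator {x<..y} t = 0"
      by (subst (asm) nn_integral_0_iff_AE) auto
    then have "AE t in lborel. t \<notin> {x<..y}"
      by eventually_elim (use pos in \<open>force simp: indicator_def\<close>)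
    then have "{x<..y} \<in> null_sets lborel"
      by (subst AE_iff_null_sets) auto
    then have "emeasure lborel {x<..y} = 0" by blast
    then show False using xy by simp
  qed
qed

lemma (in prob_space) order_stat_regression_equation:
  fixes X :: "nat \<Rightarrow> 'a \<Rightarrow> real" and h :: "real \<Rightarrow> real"
  assumes ind: "indep_vars (\<lambda>_. borel) X {1..}"
    and D: "\<And>j. 1 \<le> j \<Longrightarrow> distr M borel (X j) = D"
    and i: "1 \<le> i" "i \<le> m"
    and S: "open S" and h: "continuous_on S h"
    and F: "\<And>x. isCont (cdf D) x"
    and smono: "\<And>x y. x \<in> S \<Longrightarrow> x < y \<Longrightarrow> cdf D x < cdf D y"
    and W: "integrable M (order_stat X i (Suc m))"
    and ce: "AE \<omega> in M. real_cond_exp M (vimage_algebra (space M) (order_stat X i m) borel)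
        (order_stat X i (Suc m)) \<omega> = order_stat X i m \<omega> - h (order_stat X i m \<omega>)"
    and x: "x \<in> S" and pos: "0 < cdf D x" and lt: "cdf D x < 1"
  shows "set_integrable lborel {..x} (\<lambda>t. cdf D t ^ i)"
    and "h x * cdf D x ^ (i - 1) = (LINT t:{..x}|lborel. cdf D t ^ i)"
proof -
  have X: "random_variable borel (X j)" if "1 \<le> j" for j
    using ind that unfolding indep_vars_def by auto
  interpret D: real_distribution D
    using D[of 1] real_distribution_distr[OF X[of 1]] by simp
  \<comment> \<open>Writing i = l + 1 removes the truncated subtraction in i - 1.\<close>
  obtain l where l: "i = Suc l" "l < m" using i by (cases i) auto
  define Z where "Z = order_stat X i m"
  define W' where "W' = order_stat X i (Suc m)"
  define F where "F = cdf D"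
  define C where "C = real (m choose l)"
  define K where "K y = C * ((1 - F x) ^ (m - l) - (1 - F y) ^ (m - l))" for y
  define I where "I y = (\<integral>\<^sup>+\<omega>. ennreal (Z \<omega> - W' \<omega>) * indicator {x<..y} (Z \<omega>) \<partial>M)" for y
  define P where "P y = prob {\<omega> \<in> space M. x < Z \<omega> \<and> Z \<omega> \<le> y}" for y
  define N where "N y = (\<integral>\<^sup>+t. ennreal (F t ^ i) * indicator {..y} t \<partial>lborel)" for y
  define G where "G y = (LINT t:{..y}|lborel. F t ^ i)" for y
  have Z[measurable]: "Z \<in> borel_measurable M"
    unfolding Z_def using i by (intro borel_measurable_order_stat X) auto
  have F01: "0 \<le> F t" "F t \<le> 1" for t
    unfolding F_def using D.cdf_nonneg D.cdf_bounded_prob by auto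
  have Fx: "0 < F x" "F x < 1" using pos lt by (auto simp: F_def)
  have C: "0 < C" unfolding C_def using l by simp
  have Kpos: "0 < K y" if "x < y" for y
  proof -
    have "F x < F y" unfolding F_def by (rule smono[OF x that])
    then have "(1 - F y) ^ (m - l) < (1 - F x) ^ (m - l)"
      using F01(2)[of y] l by (intro power_strict_mono) auto
    then show ?thesis unfolding K_def using C by simp
  qed
  have lower: "ennreal (K y) * N x \<le> I y" and upper: "I y \<le> ennreal (K y) * N y" if "x < y" for y
    using order_stat_gap_bounds[OF ind D i that]
    unfolding K_def N_def I_def C_def Z_def W'_def F_def l(1) by simp_all
  have gap: "\<forall>\<^sub>F y in at_right x. I y < \<infinity> \<and> \<bar>enn2real (I y) - h x * P y\<bar> \<le> \<epsilon> * P y" if "0 < \<epsilon>" for \<epsilon>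
  proof -
    have "isCont h x" using h S x continuous_on_eq_continuous_at by blast
    then have "\<exists>\<delta>>0. \<forall>z. dist z x < \<delta> \<longrightarrow> dist (h z) (h x) < \<epsilon>"
      using that unfolding continuous_at_eps_delta by simp
    then obtain \<delta> where \<delta>: "\<delta> > 0" "\<And>z. dist z x < \<delta> \<Longrightarrow> dist (h z) (h x) < \<epsilon>"
      by auto
    have "I y < \<infinity> \<and> \<bar>enn2real (I y) - h x * P y\<bar> \<le> \<epsilon> * P y" if y: "x < y" "y < x + \<delta>" for y
    proof -
      have "\<bar>h z - h x\<bar> \<le> \<epsilon>" if "z \<in> {x<..y}" for z
        using \<delta>(2)[of z] that y by (simp add: dist_real_def)
      moreover have "W' \<omega> \<le> Z \<omega>" for \<omega>
        unfolding Z_def W'_def by (rule order_stat_Suc_le[OF i])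
      ultimately show ?thesis
        unfolding I_def P_def
        using cond_exp_gap[OF Z W[folded W'_def] _ ce[folded W'_def Z_def], of x y "h x" \<epsilon>] by blast
    qed
    then show ?thesis
      unfolding eventually_at_right_field using \<delta>(1) by (intro exI[of _ "x + \<delta>"]) auto
  qed
  have cont: "continuous_on UNIV (\<lambda>t. F t ^ i)"
    unfolding F_def using F by (intro continuous_at_imp_continuous_on ballI continuous_intros) auto
  then have [measurable]: "(\<lambda>t. F t ^ i) \<in> borel_measurable borel"
    by (rule borel_measurable_continuous_onI)
  \<comment> \<open>A single y > x with finite mean gap suffices: K(y) G(x) is at most that mean,
    and K(y) > 0.\<close>
  have int: "set_integrable lborel {..x} (\<lambda>t. F t ^ i)"
  proof -
    have "\<forall>\<^sub>F y in at_right x. x < y \<and> I y < \<infinity>"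
      using gap[OF zero_less_one] eventually_at_right_less[of x] by eventually_elim auto
    then obtain y where y: "x < y" "I y < \<infinity>"
      using eventually_happens'[OF trivial_limit_at_right_real] by blast
    have "ennreal (K y) * N x < \<infinity>"
      using lower[OF y(1)] y(2) by (rule le_less_trans)
    then have Nx: "N x < \<infinity>"
      using Kpos[OF y(1)] by (auto simp: ennreal_mult_less_top)
    show ?thesis
      unfolding set_integrable_def
    proof (rule integrableI_bounded)
      have "(\<integral>\<^sup>+t. ennreal (norm (indicat_real {..x} t *\<^sub>R F t ^ i)) \<partial>lborel) = N x"
        unfolding N_def using F01 by (intro nn_integral_cong) (auto simp: indicator_def)
      then show "(\<integral>\<^sup>+t. ennreal (norm (indicat_real {..x} t *\<^sub>R F t ^ i)) \<partial>lborel) < \<infinity>"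
        using Nx by simp
    qed measurable
  qed
  then show "set_integrable lborel {..x} (\<lambda>t. cdf D t ^ i)" unfolding F_def .
  have all: "set_integrable lborel {..y} (\<lambda>t. F t ^ i)" for y
    by (rule has_real_derivative_lower_integral(1)[OF cont int])
  have G0: "0 \<le> G y" for y
    unfolding G_def set_lebesgue_integral_def by (intro integral_nonneg_AE AE_I2) (simp add: F01)
  have NG: "N y = ennreal (G y)" for y
  proof -
    have "N y = (\<integral>\<^sup>+t. ennreal (indicat_real {..y} t *\<^sub>R F t ^ i) \<partial>lborel)"
      unfolding N_def by (intro nn_integral_cong) (auto simp: indicator_def)
    also have "\<dots> = ennreal (G y)"
      unfolding G_def set_lebesgue_integral_def
      using all[of y] F01 by (intro nn_integral_eq_integral) (auto simp: set_integrable_def)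
    finally show ?thesis .
  qed
  have "isCont G x"
    unfolding G_def by (rule DERIV_isCont[OF has_real_derivative_lower_integral(2)[OF cont int]])
  then have Glim: "(G \<longlongrightarrow> G x) (at_right x)"
    unfolding isCont_def by (rule filterlim_mono) (auto simp: at_le)
  have Fev: "\<forall>\<^sub>F y in at_right x. F x < F y"
    using eventually_at_right_less[of x] by eventually_elim (simp add: F_def smono[OF x])
  \<comment> \<open>F(y) approaches F(x) without attaining it, so difference quotients in a variable
    v at F(x) can be composed with F.\<close>
  have Flim: "filterlim F (at (F x)) (at_right x)"
  proof (rule filterlim_atI)
    have "isCont F x" unfolding F_def by (rule F)
    then show "(F \<longlongrightarrow> F x) (at_right x)"
      unfolding isCont_def by (rule filterlim_mono) (auto simp: at_le)
    show "\<forall>\<^sub>F y in at_right x. F y \<noteq> F x"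
      using Fev by eventually_elim simp
  qed
  have Klim: "((\<lambda>y. K y / (F y - F x)) \<longlongrightarrow> C * (real (m - l) * (1 - F x) ^ (m - Suc l))) (at_right x)"
  proof -
    have "((\<lambda>v. - C * (1 - v) ^ (m - l)) has_real_derivative C * (real (m - l) * (1 - F x) ^ (m - Suc l))) (at (F x))"
      by (rule derivative_eq_intros refl)+ simp
    then have "((\<lambda>v. (- C * (1 - v) ^ (m - l) - (- C * (1 - F x) ^ (m - l))) / (v - F x)) \<longlongrightarrow>
        C * (real (m - l) * (1 - F x) ^ (m - Suc l))) (at (F x))"
      unfolding has_field_derivative_iff .
    from filterlim_compose[OF this Flim] show ?thesis
      unfolding K_def by (simp add: algebra_simps)
  qed
  define Q where "Q u = (\<Sum>j=Suc l..m. real (m choose j) * u ^ j * (1 - u) ^ (m - j))" for u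
  have Peq: "P y = Q (F y) - Q (F x)" if "x < y" for y
  proof -
    have eq: "{\<omega> \<in> space M. x < Z \<omega> \<and> Z \<omega> \<le> y} = {\<omega> \<in> space M. Z \<omega> \<le> y} - {\<omega> \<in> space M. Z \<omega> \<le> x}"
      by auto
    have "P y = prob {\<omega> \<in> space M. Z \<omega> \<le> y} - prob {\<omega> \<in> space M. Z \<omega> \<le> x}"
      unfolding P_def eq by (rule finite_measure_Diff) (use that in auto)
    then show ?thesis
      using prob_order_stat_le[OF ind D i, of y] prob_order_stat_le[OF ind D i, of x]
      unfolding Z_def Q_def F_def l(1) by simp
  qed
  have Plim: "((\<lambda>y. P y / (F y - F x)) \<longlongrightarrow>
      real (m choose l) * real (m - l) * F x ^ l * (1 - F x) ^ (m - Suc l)) (at_right x)"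
  proof -
    have "((\<lambda>v. (Q v - Q (F x)) / (v - F x)) \<longlongrightarrow>
        real (m choose l) * real (m - l) * F x ^ l * (1 - F x) ^ (m - Suc l)) (at (F x))"
      using has_real_derivative_binomial_tail[OF l(2), of "F x"]
      unfolding Q_def has_field_derivative_iff .
    from filterlim_compose[OF this Flim] show ?thesis
      by (rule Lim_transform_eventually)
         (use eventually_at_right_less[of x] in eventually_elim, simp add: Peq)
  qed
  have "C * (real (m - l) * (1 - F x) ^ (m - Suc l)) * G x
      = h x * (real (m choose l) * real (m - l) * F x ^ l * (1 - F x) ^ (m - Suc l))"
  proof (rule limit_quotients_eq[OF Fev Klim Plim Glim])
    show "\<forall>\<^sub>F y in at_right x. K y * G x \<le> enn2real (I y) \<and> enn2real (I y) \<le> K y * G y"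
      using eventually_at_right_less[of x] gap[OF zero_less_one]
    proof eventually_elim
      case (elim y)
      then have "I y = ennreal (enn2real (I y))" by simp
      then have "ennreal (K y * G x) \<le> ennreal (enn2real (I y))"
        "ennreal (enn2real (I y)) \<le> ennreal (K y * G y)"
        using lower[of y] upper[of y] elim Kpos[of y] G0
        by (simp_all add: NG ennreal_mult' less_imp_le)
      then show ?case
        using Kpos[of y] elim G0[of y] by (auto intro!: enn2real_leI)
    qed
    show "\<forall>\<^sub>F y in at_right x. \<bar>enn2real (I y) - h x * P y\<bar> \<le> \<epsilon> * P y" if "0 < \<epsilon>" for \<epsilon>
      using gap[OF that] by eventually_elim simp
  qed
  then have "(C * real (m - l) * (1 - F x) ^ (m - Suc l)) * (h x * F x ^ l)
      = (C * real (m - l) * (1 - F x) ^ (m - Suc l)) * G x"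
    unfolding C_def by (simp only: ac_simps)
  \<comment> \<open>The common factor of the two limits, positive because F(x) < 1, is
    cancelled.\<close>
  moreover have "C * real (m - l) * (1 - F x) ^ (m - Suc l) > 0"
    using C l Fx by simp
  ultimately have "h x * F x ^ l = G x"
    by (metis less_irrefl mult_left_cancel)
  then show "h x * cdf D x ^ (i - 1) = (LINT t:{..x}|lborel. cdf D t ^ i)"
    unfolding G_def F_def l(1) by simp
qed

text \<open>Positivity of h, existence of the limit L and integrability are part of the conclusion,
  because \<open>powr\<close> and the integral are total and the formula alone could hold through
  default values. L is an extended real, as the limit may be infinite.\<close>

theorem theorem3p9:
  fixes M :: "'a measure" and X :: "nat \<Rightarrow> 'a \<Rightarrow> real"
    and F f h :: "real \<Rightarrow> real" and a b :: ereal and i m :: nat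
  assumes "prob_space M"
    and "prob_space.indep_vars M (\<lambda>_. borel) X {1..}"
    and "\<And>n. 1 \<le> n \<Longrightarrow> cdf (distr M borel (X n)) = F"
    and "distributed M lborel (X 1) (\<lambda>x. ennreal (f x))"
    and "a < b" and "einterval a b = {x. 0 < F x \<and> F x < 1}"
    and "\<And>x. x \<in> einterval a b \<Longrightarrow> 0 < f x"
    and "2 \<le> i" and "i \<le> m"
    and "integrable M (order_stat X i (m + 1))"
    and "h differentiable_on einterval a b"
    and "AE \<omega> in M.
           real_cond_exp M (vimage_algebra (space M) (order_stat X i m) borel)
             (order_stat X i (m + 1)) \<omega>
           = order_stat X i m \<omega> - h (order_stat X i m \<omega>)"
  shows "(\<forall>x\<in>einterval a b. 0 < h x) \<and>
    (\<exists>L::ereal. 0 < L \<and>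
      ((\<lambda>x. ereal (h (real_of_ereal x))) \<longlongrightarrow> L) (at_left b) \<and>
      (\<forall>x\<in>einterval a b.
        interval_lebesgue_integrable lborel (ereal x) b
          (\<lambda>t. h t powr (- (real i / (real i - 1)))) \<and>
        F x = h x powr (- (1 / (real i - 1))) /
          (neg_powr L (1 / (real i - 1))
            + 1 / (real i - 1) *
              (LBINT t=ereal x..b. h t powr (- (real i / (real i - 1)))))))"
proof -
  interpret prob_space M by fact
  define D where "D = distr M borel (X 1)"
  have X: "random_variable borel (X j)" if "1 \<le> j" for j
    using assms(2) that unfolding indep_vars_def by auto
  interpret D: real_distribution D
    unfolding D_def by (rule real_distribution_distr[OF X]) simp
  have F: "F = cdf D" unfolding D_def using assms(3)[of 1] by simp
  have D: "distr M borel (X j) = D" if "1 \<le> j" for j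
    using assms(3)[OF that] F
    by (intro cdf_unique real_distribution_distr X that D.real_distribution_axioms) simp
  have i: "1 \<le> i" "i \<le> m" using assms(8,9) by auto
  let ?S = "einterval a b"
  have S01: "0 < F t" "F t < 1" if "t \<in> ?S" for t
    using that assms(6) by auto
  have Fcont: "isCont F t" for t
    unfolding F D_def by (rule density_distr_cdf(1)[OF assms(4)])
  have smono: "F x < F y" if "x \<in> ?S" "x < y" for x y
  proof -
    \<comment> \<open>The point y may lie beyond b, where nothing is known about f. An intermediate
      r below both b and y keeps (x, r] inside the interval.\<close>
    have "ereal x < min b (ereal y)" using that by (simp add: einterval_iff)
    then obtain r where r: "ereal x < ereal r" "ereal r < min b (ereal y)"
      using ereal_dense2 by blast
    have "F x < F r" unfolding F D_def
    proof (rule density_distr_cdf(2)[OF assms(4)])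
      show "x < r" using r by simp
      fix t assume t: "t \<in> {x<..r}"
      have "a < ereal t"
        using that(1) t less_trans[of a "ereal x" "ereal t"] by (simp add: einterval_iff)
      moreover have "ereal t < b"
        using r(2) t le_less_trans[of "ereal t" "ereal r" b] by simp
      ultimately show "0 < f t" by (intro assms(7)) (simp add: einterval_iff)
    qed
    also have "F r \<le> F y" unfolding F using r by (intro D.cdf_nondecreasing) simp
    finally show ?thesis .
  qed
  have reg: "set_integrable lborel {..x} (\<lambda>t. F t ^ i)"
    "h x * F x ^ (i - 1) = (LINT t:{..x}|lborel. F t ^ i)" if "x \<in> ?S" for x
    unfolding F
    by (rule order_stat_regression_equation[OF assms(2) D i open_einterval
        differentiable_imp_continuous_on[OF assms(11)] Fcont[unfolded F] smono[unfolded F]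
        assms(10)[unfolded Suc_eq_plus1[symmetric]] assms(12)[unfolded Suc_eq_plus1[symmetric]]
        that S01[OF that, unfolded F]]; assumption)+
  obtain x0 where x0: "x0 \<in> ?S"
    using ereal_dense2[OF assms(5)] by (auto simp: einterval_iff)
  have cont: "continuous_on UNIV (\<lambda>t. F t ^ i)"
    using Fcont by (intro continuous_at_imp_continuous_on ballI continuous_intros)
  define G where "G y = (LINT t:{..y}|lborel. F t ^ i)" for y
  have G': "(G has_real_derivative F x ^ i) (at x)" for x
    unfolding G_def by (rule has_real_derivative_lower_integral(2)[OF cont reg(1)[OF x0]])
  have F0: "0 \<le> F t" for t unfolding F by (rule D.cdf_nonneg)
  have Gmono: "mono G"
  proof (rule monoI)
    fix x y :: real assume "x \<le> y"
    then show "G x \<le> G y"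
      by (rule DERIV_nonneg_imp_nondecreasing[of x y G]) (meson G' F0 zero_le_power)
  qed
  have Gpos: "0 < G x" if "x \<in> ?S" for x
  proof -
    have "a < ereal x" using that by (simp add: einterval_iff)
    \<comment> \<open>On [r, x] the derivative F^i of G is strictly positive, so G increases
      strictly from a value that is at least 0.\<close>
    then obtain r where r: "a < ereal r" "ereal r < ereal x" using ereal_dense2 by blast
    have "0 \<le> G r"
      unfolding G_def set_lebesgue_integral_def by (intro integral_nonneg_AE AE_I2) (simp add: F0)
    also have "G r < G x"
    proof (rule DERIV_pos_imp_increasing[of r x G])
      show "r < x" using r by simp
      fix t assume t: "r \<le> t" "t \<le> x"
      have "a < ereal t" using r t less_le_trans[of a "ereal r" "ereal t"] by simp
      moreover have "ereal t < b"
        using that t le_less_trans[of "ereal t" "ereal x" b] by (simp add: einterval_iff)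
      ultimately have "0 < F t ^ i" using S01(1)[of t] by (simp add: einterval_iff)
      then show "\<exists>d. (G has_real_derivative d) (at t) \<and> 0 < d" using G' by blast
    qed
    finally show ?thesis .
  qed
  have Flim: "((F \<circ> real_of_ereal) \<longlongrightarrow> 1) (at_left b)"
  proof (cases b)
    case (real r)
    \<comment> \<open>A finite endpoint lies outside the open interval, so F is 0 or 1 there; it
      exceeds 0 by comparison with \<open>x0\<close>, and continuity gives the limit.\<close>
    have "r \<notin> ?S" using real by (simp add: einterval_iff)
    moreover have "0 < F r"
    proof -
      have "x0 \<le> r" using x0 real by (simp add: einterval_iff)
      then have "F x0 \<le> F r" unfolding F by (rule D.cdf_nondecreasing)
      then show ?thesis using S01(1)[OF x0] by simp
    qed
    moreover have "F r \<le> 1" unfolding F by (rule D.cdf_bounded_prob)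
    ultimately have "F r = 1" using assms(6) by fastforce
    then have "(F \<longlongrightarrow> 1) (at r)" using Fcont[of r] by (simp add: isCont_def)
    then have "(F \<longlongrightarrow> 1) (at_left r)" by (rule filterlim_mono) (auto simp: at_le)
    then show ?thesis unfolding real ereal_tendsto_simps .
  next
    case PInf
    show ?thesis unfolding PInf ereal_tendsto_simps F by (rule D.cdf_lim_at_top_prob)
  next
    case MInf
    then show ?thesis using assms(5) by simp
  qed
  show ?thesis
    by (rule solve_integral_equation[OF assms(5,8) S01(1) Fcont Flim Gpos G' Gmono
        reg(2)[folded G_def]])
qed

end
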